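(* Let $m,n$ be positive integers and let $(S,T)$ be a pair of random variables on a common probability space taking values in $\{0,1,\dots,m\}\times\{0,1,\dots,n\}$. Then for all integers $1\le k\le m$ and $1\le l\le n$, $$P(S\ge 1,T\ge 1)\ \le\ \frac{\binom{m}{k}\binom{n}{l}-\overline{S}_{k,l}}{\binom{m-1}{k-1}\binom{n-1}{l-1}},$$ where $$\overline{S}_{k,l}=\binom{m}{k}E\left[\binom{n-T}{l}\right]+\binom{n}{l}E\left[\binom{m-S}{k}\right]-E\left[\binom{m-S}{k}\binom{n-T}{l}\right].$$
   Context: For non-negative integers $a,r$, $\binom{a}{r}$ is the usual binomial coefficient, with $\binom{a}{0}=1$ and $\binom{a}{r}=0$ if $r>a$. $E$ denotes expectation. *)

theory Defs
  imports "HOL-Probability.Probability"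
begin

(* The differences n - T and m - S are truncated natural-number subtractions; they agree with
   the integer ones whenever S and T take values in {0..m} and {0..n}. *)
definition Sbar ::
  "'a measure \<Rightarrow> ('a \<Rightarrow> nat) \<Rightarrow> ('a \<Rightarrow> nat) \<Rightarrow> nat \<Rightarrow> nat \<Rightarrow> nat \<Rightarrow> nat \<Rightarrow> real" where
  "Sbar M S T m n k l =
     real (m choose k) * (\<integral>\<omega>. real ((n - T \<omega>) choose l) \<partial>M)
   + real (n choose l) * (\<integral>\<omega>. real ((m - S \<omega>) choose k) \<partial>M)
   - (\<integral>\<omega>. real ((m - S \<omega>) choose k) * real ((n - T \<omega>) choose l) \<partial>M)"

end

theory Submission
  imports Defs
begin

text \<open>The numerator is the expectation of
  \<open>(C(m,k) - C(m-S,k)) (C(n,l) - C(n-T,l))\<close>. Both factors are non-negative, and by Pascal's rule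
  they are at least \<open>C(m-1,k-1)\<close> and \<open>C(n-1,l-1)\<close> when \<open>S \<ge> 1\<close> and \<open>T \<ge> 1\<close>; Markov's inequality
  does the rest.\<close>

lemma binomial_pred_le_diff:
  fixes m k s :: nat
  assumes "1 \<le> k" "k \<le> m" "1 \<le> s"
  shows "real ((m - 1) choose (k - 1)) \<le> real (m choose k) - real ((m - s) choose k)"
proof -
  have "m choose k = ((m - 1) choose (k - 1)) + ((m - 1) choose k)"
    using assms choose_reduce_nat[of m k] by simp
  moreover have "(m - s) choose k \<le> (m - 1) choose k"
    using assms by (intro binomial_right_mono) auto
  ultimately show ?thesis by simp
qed

theorem mainTheorem4:
  fixes M :: "'a measure" and S T :: "'a \<Rightarrow> nat" and m n k l :: nat
  assumes "prob_space M"
    and "m \<ge> 1" and "n \<ge> 1"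
    and "S \<in> measurable M (count_space {0..m})"
    and "T \<in> measurable M (count_space {0..n})"
    and "1 \<le> k" and "k \<le> m" and "1 \<le> l" and "l \<le> n"
  shows "measure M {\<omega> \<in> space M. S \<omega> \<ge> 1 \<and> T \<omega> \<ge> 1}
    \<le> (real (m choose k) * real (n choose l) - Sbar M S T m n k l)
       / (real ((m - 1) choose (k - 1)) * real ((n - 1) choose (l - 1)))"
proof -
  interpret prob_space M by fact
  \<comment> \<open>Composing with the identity enlarges the codomain, so that
    \<open>measurable\<close> can treat arbitrary functions of \<open>S\<close> and
    \<open>T\<close>.\<close>
  have [measurable]: "S \<in> measurable M (count_space UNIV)" "T \<in> measurable M (count_space UNIV)"
    using assms(4,5) measurable_compose[of _ M "count_space _" "\<lambda>i. i" "count_space UNIV"]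
    by auto
  define f where "f = (\<lambda>\<omega>. real ((m - S \<omega>) choose k))"
  define g where "g = (\<lambda>\<omega>. real ((n - T \<omega>) choose l))"
  define A where "A = real (m choose k)"
  define B where "B = real (n choose l)"
  define h where "h = (\<lambda>\<omega>. (A - f \<omega>) * (B - g \<omega>))"
  define c where "c = real ((m - 1) choose (k - 1)) * real ((n - 1) choose (l - 1))"
  have [measurable]: "f \<in> borel_measurable M" "g \<in> borel_measurable M"
    unfolding f_def g_def by measurable
  \<comment> \<open>These bounds give integrability on a probability space, and later
    \<open>h \<ge> 0\<close> for Markov's inequality.\<close>
  have f: "0 \<le> f \<omega>" "f \<omega> \<le> A" and g: "0 \<le> g \<omega>" "g \<omega> \<le> B" for \<omega>
    by (auto simp: f_def g_def A_def B_def intro!: binomial_right_mono)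
  have int: "integrable M f" "integrable M g" "integrable M (\<lambda>\<omega>. f \<omega> * g \<omega>)"
  proof -
    show "integrable M f" by (rule integrable_const_bound[where B = A]) (simp_all add: f)
    show "integrable M g" by (rule integrable_const_bound[where B = B]) (simp_all add: g)
    show "integrable M (\<lambda>\<omega>. f \<omega> * g \<omega>)"
      by (rule integrable_const_bound[where B = "A * B"]) (simp_all add: f g abs_mult mult_mono')
  qed
  \<comment> \<open>Inclusion-exclusion form: the bracket integrates termwise to
    \<open>Sbar\<close>, and the constant \<open>A * B\<close> to itself because the total mass is
    1.\<close>
  have h_eq: "h = (\<lambda>\<omega>. A * B - (A * g \<omega> + B * f \<omega> - f \<omega> * g \<omega>))"
    by (simp add: h_def algebra_simps)
  have int_h: "integrable M h" unfolding h_eq using int by auto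
  have expectation_h: "expectation h = A * B - Sbar M S T m n k l"
    unfolding h_eq Sbar_def using int by (simp add: f_def g_def A_def B_def prob_space)
  have "c > 0"
    using assms(6-9) by (simp add: c_def zero_less_binomial_iff)
  \<comment> \<open>The two factorwise lower bounds are non-negative, so they may be
    multiplied.\<close>
  have "c \<le> h \<omega>" if "S \<omega> \<ge> 1" "T \<omega> \<ge> 1" for \<omega>
    unfolding c_def h_def f_def g_def A_def B_def
    using assms(6-9) that by (intro mult_mono' binomial_pred_le_diff) auto
  then have "prob {\<omega> \<in> space M. S \<omega> \<ge> 1 \<and> T \<omega> \<ge> 1} \<le> prob {\<omega> \<in> space M. h \<omega> \<ge> c}"
    unfolding h_def by (intro finite_measure_mono) auto
  \<comment> \<open>The \<open>{}\<close> fills a measurable-set parameter of the Markov rule; it is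
    unrelated to the real constant \<open>A\<close>.\<close>
  also have "\<dots> \<le> expectation h / c"
    using f g \<open>c > 0\<close>
    by (intro integral_Markov_inequality_measure[OF int_h, where A = "{}"]) (auto simp: h_def)
  finally show ?thesis by (simp add: expectation_h c_def A_def B_def)
qed

end
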